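(* Let $X\subseteq U$ be a fixed set of $|X|=m$ keys and let $h:U\to[n]$ be a simple tabulation hash function. Then with high probability $$|h(X)|\ge n\left(1-\left(1-\frac1n\right)^{\Omega(m)}\right);$$ that is, for every constant $\gamma>0$ there is a constant $\beta>0$ (depending only on $\gamma$ and $c$) such that $|h(X)|\ge n\left(1-(1-1/n)^{m/\beta}\right)$ with probability at least $1-O(n^{-\gamma})$.
   Context: Simple tabulation hashing: the key universe is $U=[u]$, each key $x\in U$ is viewed as a vector $(x[0],\dots,x[c-1])$ of $c=O(1)$ characters from $\Sigma=[u^{1/c}]$; the range is $[n]=[2^r]$. $h(x)=h_0(x[0])\oplus\cdots\oplus h_{c-1}(x[c-1])$ with $h_0,\dots,h_{c-1}:\Sigma\to[2^r]$ independent fully random functions and $\oplus$ bitwise XOR. "With high probability" means with probability $1-O(n^{-\gamma})$ for any prescribed constant $\gamma>0$. *)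

theory Defs
  imports "HOL-Probability.Probability"
begin

text \<open>Keys: vectors of c characters from the alphabet [s] = {0..<s}; the key universe
  [u] with u = s^c is identified with these vectors.\<close>
definition keys :: "nat \<Rightarrow> nat \<Rightarrow> nat list set" where
  "keys c s = {x. length x = c \<and> (\<forall>i<c. x ! i < s)}"

text \<open>Tables: T (i, a) = h_i(a) \<in> [2^r] for i < c, a < s (extensional elsewhere).\<close>
definition tables :: "nat \<Rightarrow> nat \<Rightarrow> nat \<Rightarrow> (nat \<times> nat \<Rightarrow> nat) set" where
  "tables c s r = Pi\<^sub>E ({..<c} \<times> {..<s}) (\<lambda>_. {..<2^r})"

definition tab_hash :: "nat \<Rightarrow> (nat \<times> nat \<Rightarrow> nat) \<Rightarrow> nat list \<Rightarrow> nat" where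
  "tab_hash c T x = fold (\<lambda>i acc. Bit_Operations.xor acc (T (i, x ! i))) [0..<c] 0"

definition table_pmf :: "nat \<Rightarrow> nat \<Rightarrow> nat \<Rightarrow> (nat \<times> nat \<Rightarrow> nat) pmf" where
  "table_pmf c s r = pmf_of_set (tables c s r)"

end

theory Submission
  imports Defs "HOL-Real_Asymp.Real_Asymp"
begin

text \<open>
  Write \<open>n = 2^r\<close> and let \<open>L\<close> be the number of empty bins. In every set \<open>X\<close> of keys some character
  is shared by a group \<open>G\<close> of at most \<open>|X| powr (1 - 1/c)\<close> keys; peeling such groups one after the
  other exhibits \<open>h(X)\<close> as a union of sets \<open>h(G)\<close>, each translated by a uniform value independent of
  the groups peeled after it. If \<open>|X|\<close> is at most \<open>n powr (1 + 1/(2c))\<close>, the groups are polynomially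
  smaller than \<open>n\<close>, so with high probability no bin contains more than a constant number \<open>d\<close> of keys
  of any one group: more than \<open>K^c\<close> keys in a bin include \<open>K + 1\<close> keys with pairwise distinct
  characters at one position, and those hash independently. Hence \<open>|h(G)| \<ge> |G| / d\<close>, and a group
  multiplies the expectation of \<open>L powr t\<close> by at most \<open>exp (- t |G| / (2 d n))\<close>, as long as
  \<open>t |G| \<le> L\<close> or \<open>t \<le> 1\<close>.

  Markov's inequality for \<open>L powr t\<close> with a polynomially large \<open>t m / n\<close> settles
  \<open>m = O(n ln n)\<close>; for larger \<open>m\<close>, the case \<open>t = 1\<close> applied to a subset of \<open>\<Theta>(n ln n)\<close> keys shows that no
  bin is empty. If \<open>m\<close> is polynomially smaller than \<open>n\<close>, the bound on the loads suffices.
\<close>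

section \<open>Translating one table entry\<close>

lemma xor_nat_less_power2:
  fixes a b :: nat
  assumes "a < 2 ^ r" "b < 2 ^ r"
  shows "xor a b < 2 ^ r"
  using assms by (metis take_bit_nat_eq_self_iff take_bit_xor)

lemma xor_xor_cancel_right [simp]: "xor (xor a b) b = (a :: nat)"
  by (simp add: xor.assoc)

lemma xor_xor_cancel_left [simp]: "xor a (xor a b) = (b :: nat)"
  by (simp flip: xor.assoc)

lemma inj_on_xor: "inj_on (\<lambda>y. xor y v) A" for v :: nat
  by (rule inj_on_inverseI[where g = "\<lambda>y. xor y v"]) simp

lemma tab_hash_Suc: "tab_hash (Suc c) T x = xor (tab_hash c T x) (T (c, x ! c))"
  by (simp add: tab_hash_def)

lemma tab_hash_0 [simp]: "tab_hash 0 T x = 0"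
  by (simp add: tab_hash_def)

lemma tab_hash_less:
  assumes "T \<in> tables c s r" "x \<in> keys c s"
  shows "tab_hash c T x < 2 ^ r"
proof -
  have "tab_hash k T x < 2 ^ r" if "k \<le> c" for k
    using that
  proof (induction k)
    case (Suc k)
    have "T (k, x ! k) < 2 ^ r"
      using assms Suc.prems by (auto simp: tables_def keys_def PiE_iff)
    with Suc show ?case
      by (simp add: tab_hash_Suc xor_nat_less_power2)
  qed simp
  then show ?thesis by simp
qed

definition shift_entry :: "nat \<times> nat \<Rightarrow> nat \<Rightarrow> (nat \<times> nat \<Rightarrow> nat) \<Rightarrow> nat \<times> nat \<Rightarrow> nat" where
  "shift_entry \<alpha> v T = T(\<alpha> := xor (T \<alpha>) v)"

lemma tab_hash_shift_entry:
  "tab_hash c (shift_entry (i, a) v T) x =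
    (if i < c \<and> x ! i = a then xor (tab_hash c T x) v else tab_hash c T x)"
proof (induction c)
  case (Suc c)
  show ?case
    unfolding tab_hash_Suc Suc.IH
    by (auto simp: shift_entry_def less_Suc_eq ac_simps)
qed simp

lemma finite_tables [simp]: "finite (tables c s r)"
  by (auto simp: tables_def intro: finite_PiE)

lemma tables_nonempty [simp]: "tables c s r \<noteq> {}"
  by (auto simp: tables_def PiE_eq_empty_iff lessThan_empty_iff)

lemma card_tables_pos [simp]: "card (tables c s r) > 0"
  by (simp add: card_gt_0_iff)

lemma finite_keys [simp]: "finite (keys c s)"
proof (rule finite_subset)
  show "keys c s \<subseteq> {xs. set xs \<subseteq> {..<s} \<and> length xs = c}"
    by (auto simp: keys_def in_set_conv_nth)
qed (simp add: finite_lists_length_eq)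

lemma bij_betw_shift_entry:
  assumes "i < c" "a < s" "v < 2 ^ r"
  shows "bij_betw (shift_entry (i, a) v) (tables c s r) (tables c s r)"
proof -
  have involution: "shift_entry (i, a) v (shift_entry (i, a) v T) = T" for T
    by (simp add: shift_entry_def)
  have "shift_entry (i, a) v T \<in> tables c s r" if "T \<in> tables c s r" for T
  proof -
    have "xor (T (i, a)) v < 2 ^ r"
      using that assms by (intro xor_nat_less_power2) (auto simp: tables_def PiE_iff)
    then show ?thesis
      using that assms unfolding tables_def shift_entry_def
      by (metis PiE_fun_upd SigmaI insert_absorb lessThan_iff)
  qed
  then show ?thesis
    by (intro bij_betw_byWitness[where f' = "shift_entry (i, a) v"]) (auto simp: involution)
qed

text \<open>For each fixed \<open>v\<close> the shift permutes the tables. Summing over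
  \<open>v\<close> therefore resamples one entry uniformly while all others stay fixed, which takes
  the place of conditioning.\<close>

lemma sum_tables_shift_entry:
  fixes F :: "(nat \<times> nat \<Rightarrow> nat) \<Rightarrow> real"
  assumes "i < c" "a < s"
  shows "2 ^ r * (\<Sum>T\<in>tables c s r. F T)
       = (\<Sum>T\<in>tables c s r. \<Sum>v<2 ^ r. F (shift_entry (i, a) v T))"
proof -
  have "(\<Sum>T\<in>tables c s r. \<Sum>v<2 ^ r. F (shift_entry (i, a) v T))
      = (\<Sum>v<2 ^ r. \<Sum>T\<in>tables c s r. F (shift_entry (i, a) v T))"
    by (rule sum.swap)
  also have "\<dots> = (\<Sum>v<2 ^ r :: nat. \<Sum>T\<in>tables c s r. F T)"
    using assms by (intro sum.cong refl sum.reindex_bij_betw bij_betw_shift_entry) auto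
  finally show ?thesis by simp
qed

section \<open>Probabilities as counts of tables, and the union bound\<close>

lemma prob_table_pmf:
  "measure_pmf.prob (table_pmf c s r) {T. P T}
     = real (card {T \<in> tables c s r. P T}) / real (card (tables c s r))"
  by (simp add: table_pmf_def measure_pmf_of_set Int_def)

lemma prob_table_pmf_mono:
  assumes "\<And>T. T \<in> tables c s r \<Longrightarrow> P T \<Longrightarrow> Q T"
  shows "measure_pmf.prob (table_pmf c s r) {T. P T} \<le> measure_pmf.prob (table_pmf c s r) {T. Q T}"
  unfolding prob_table_pmf using assms
  by (intro divide_right_mono of_nat_mono card_mono) auto

lemma prob_table_pmf_Ex_le:
  assumes "finite A" "\<And>a. a \<in> A \<Longrightarrow> measure_pmf.prob (table_pmf c s r) {T. P a T} \<le> p"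
  shows "measure_pmf.prob (table_pmf c s r) {T. \<exists>a\<in>A. P a T} \<le> real (card A) * p"
proof -
  have "measure_pmf.prob (table_pmf c s r) {T. \<exists>a\<in>A. P a T}
      = measure_pmf.prob (table_pmf c s r) (\<Union>a\<in>A. {T. P a T})"
    by (rule arg_cong[where f = "measure_pmf.prob (table_pmf c s r)"]) auto
  also have "\<dots> \<le> (\<Sum>a\<in>A. measure_pmf.prob (table_pmf c s r) {T. P a T})"
    using assms(1) by (intro measure_pmf.finite_measure_subadditive_finite) auto
  also have "\<dots> \<le> (\<Sum>a\<in>A. p)"
    using assms(2) by (rule sum_mono)
  finally show ?thesis by simp
qed

section \<open>Loads of small key sets\<close>

text \<open>Shifting the table entry at the character that distinguishes a key changes the hash of that
  key only.\<close>

lemma card_tables_independent: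
  assumes "finite B" "B \<subseteq> keys c s" "i < c" "inj_on (\<lambda>x. x ! i) B"
  shows "2 ^ (r * card B) * card {T \<in> tables c s r. \<forall>x\<in>B. tab_hash c T x = y}
           \<le> card (tables c s r)"
  using assms
proof (induction B rule: finite_induct)
  case (insert x B)
  let ?N = "\<lambda>B T. of_bool (\<forall>z\<in>B. tab_hash c T z = y) :: real"
  have card_eq: "(\<Sum>T\<in>tables c s r. ?N B T) = card {T \<in> tables c s r. \<forall>x\<in>B. tab_hash c T x = y}" for B
    by (simp add: Int_def)
  have x: "x ! i < s" "\<And>z. z \<in> B \<Longrightarrow> z ! i \<noteq> x ! i"
    using insert.prems insert.hyps by (auto simp: keys_def image_iff)
  have "2 ^ r * (\<Sum>T\<in>tables c s r. ?N (insert x B) T)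
      = (\<Sum>T\<in>tables c s r. \<Sum>v<2 ^ r. ?N (insert x B) (shift_entry (i, x ! i) v T))"
    using insert.prems x by (intro sum_tables_shift_entry) auto
  also have "\<dots> = (\<Sum>T\<in>tables c s r. \<Sum>v<2 ^ r. of_bool (xor (tab_hash c T x) v = y) * ?N B T)"
    using insert.prems x by (intro sum.cong refl) (auto simp: tab_hash_shift_entry)
  also have "\<dots> \<le> (\<Sum>T\<in>tables c s r. 1 * ?N B T)"
    unfolding sum_distrib_right[symmetric]
  proof (intro sum_mono mult_right_mono)
    fix T
    have "(\<Sum>v<2 ^ r. of_bool (xor (tab_hash c T x) v = y) :: real)
        = card {v. v < 2 ^ r \<and> xor (tab_hash c T x) v = y}"
      by (simp add: Int_def)
    \<comment> \<open>Cancelling the hash of \<open>x\<close> leaves a single candidate for the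
      shift \<open>v\<close>.\<close>
    also have "\<dots> \<le> card {xor (tab_hash c T x) y}"
      by (intro of_nat_mono card_mono) auto
    finally show "(\<Sum>v<2 ^ r. of_bool (xor (tab_hash c T x) v = y) :: real) \<le> 1" by simp
  qed auto
  finally have "2 ^ r * real (card {T \<in> tables c s r. \<forall>z\<in>insert x B. tab_hash c T z = y})
     \<le> real (card {T \<in> tables c s r. \<forall>z\<in>B. tab_hash c T z = y})"
    unfolding card_eq by (simp add: card_eq)
  then have "real (2 ^ r * card {T \<in> tables c s r. \<forall>z\<in>insert x B. tab_hash c T z = y})
     \<le> real (card {T \<in> tables c s r. \<forall>z\<in>B. tab_hash c T z = y})"
    by simp
  then have "2 ^ r * card {T \<in> tables c s r. \<forall>z\<in>insert x B. tab_hash c T z = y}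
     \<le> card {T \<in> tables c s r. \<forall>z\<in>B. tab_hash c T z = y}"
    by (simp only: of_nat_le_iff)
  then have "2 ^ (r * card B) * (2 ^ r * card {T \<in> tables c s r. \<forall>z\<in>insert x B. tab_hash c T z = y})
     \<le> 2 ^ (r * card B) * card {T \<in> tables c s r. \<forall>z\<in>B. tab_hash c T z = y}"
    by (rule mult_le_mono2)
  also have "\<dots> \<le> card (tables c s r)"
    using insert by auto
  finally show ?case
    using insert.hyps by (simp add: power_add algebra_simps)
qed (simp add: card_mono)

lemma prob_all_in_bin_le:
  assumes "finite B" "B \<subseteq> keys c s" "i < c" "inj_on (\<lambda>x. x ! i) B"
  shows "measure_pmf.prob (table_pmf c s r) {T. \<forall>x\<in>B. tab_hash c T x = y}
           \<le> 1 / (2 ^ r) ^ card B"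
proof -
  have "real (2 ^ (r * card B) * card {T \<in> tables c s r. \<forall>x\<in>B. tab_hash c T x = y})
           \<le> real (card (tables c s r))"
    using card_tables_independent[OF assms] by (rule of_nat_mono)
  then show ?thesis
    unfolding prob_table_pmf by (simp add: field_simps power_mult)
qed

text \<open>A key is determined by its characters, so \<open>X\<close> embeds in the product of its
  projections. This yields both a position with many characters (large load) and a character shared
  by few keys (small group).\<close>

lemma card_le_prod_characters:
  assumes "X \<subseteq> keys c s"
  shows "card X \<le> (\<Prod>i<c. card ((\<lambda>x. x ! i) ` X))"
proof -
  have fin: "finite X"
    using assms finite_keys by (rule finite_subset)
  let ?f = "\<lambda>x. restrict (\<lambda>i. x ! i) {..<c}"
  have "inj_on ?f X"
  proof (rule inj_onI)
    fix x y assume xy: "x \<in> X" "y \<in> X" "?f x = ?f y"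
    have "x ! i = y ! i" if "i < c" for i
      using fun_cong[OF xy(3), of i] that by simp
    moreover have "length x = c" "length y = c"
      using xy assms by (auto simp: keys_def)
    ultimately show "x = y"
      by (intro nth_equalityI) auto
  qed
  moreover have "?f ` X \<subseteq> Pi\<^sub>E {..<c} (\<lambda>i. (\<lambda>x. x ! i) ` X)"
    by (auto split: if_splits)
  ultimately have "card X \<le> card (Pi\<^sub>E {..<c} (\<lambda>i. (\<lambda>x. x ! i) ` X))"
    using fin by (intro card_inj_on_le) (auto intro: finite_PiE)
  then show ?thesis
    by (simp add: card_PiE)
qed

text \<open>If each position showed at most \<open>K\<close> characters, the product bound would
  give at most \<open>K ^ c\<close> keys. \<open>B\<close> takes one key for each of
  \<open>K + 1\<close> characters at a richer position.\<close>

lemma ex_distinguishing_position: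
  assumes "X \<subseteq> keys c s" "card X > K ^ c"
  obtains i B where "i < c" "B \<subseteq> X" "card B = Suc K" "inj_on (\<lambda>x. x ! i) B"
proof -
  have "\<exists>i<c. card ((\<lambda>x. x ! i) ` X) > K"
  proof (rule ccontr)
    assume "\<not> ?thesis"
    then have "(\<Prod>i<c. card ((\<lambda>x. x ! i) ` X)) \<le> (\<Prod>i<c. K)"
      by (intro prod_mono) auto
    with card_le_prod_characters[OF assms(1)] assms(2) show False by simp
  qed
  then obtain i where i: "i < c" "card ((\<lambda>x. x ! i) ` X) \<ge> Suc K"
    by (auto simp: Suc_le_eq)
  then obtain S where S: "S \<subseteq> (\<lambda>x. x ! i) ` X" "card S = Suc K"
    by (meson obtain_subset_with_card_n)
  from S(1) obtain B where B: "B \<subseteq> X" "inj_on (\<lambda>x. x ! i) B" "S = (\<lambda>x. x ! i) ` B"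
    unfolding subset_image_inj by blast
  with i S show ?thesis
    by (intro that[of i B]) (auto dest: card_image)
qed

lemma card_le_mult_card_image:
  assumes "finite A" "\<And>y. y \<in> f ` A \<Longrightarrow> card {x \<in> A. f x = y} \<le> d"
  shows "card A \<le> d * card (f ` A)"
proof -
  have "card A = (\<Sum>y\<in>f ` A. card {x \<in> A. f x = y})"
    using sum.image_gen[OF assms(1), of "\<lambda>_. 1 :: nat" f] by simp
  also have "\<dots> \<le> (\<Sum>y\<in>f ` A. d)"
    using assms(2) by (rule sum_mono)
  finally show ?thesis by (simp add: mult.commute)
qed

text \<open>Some bin receives more than \<open>K ^ c\<close> keys of \<open>A\<close>, hence
  \<open>K + 1\<close> keys that hash independently. The union bound ranges over the position, the
  \<open>K + 1\<close> keys and the bin; the choice of the bin costs one of the \<open>K + 1\<close>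
  factors \<open>2 ^ r\<close>.\<close>

lemma prob_overloaded_le:
  assumes A: "A \<subseteq> keys c s"
  shows "measure_pmf.prob (table_pmf c s r) {T. K ^ c * card (tab_hash c T ` A) < card A}
           \<le> real c * real (card A) ^ Suc K / (2 ^ r) ^ K"
proof -
  have fin: "finite A"
    using A finite_keys by (rule finite_subset)
  let ?\<B> = "\<lambda>i. {B. B \<subseteq> A \<and> card B = Suc K \<and> inj_on (\<lambda>x. x ! i) B}"
  let ?S = "Sigma {..<c} ?\<B> \<times> {..<2 ^ r :: nat}"
  have finB: "finite (?\<B> i)" for i
    by (rule finite_subset[of _ "Pow A"]) (use fin in auto)
  have cardB: "card (?\<B> i) \<le> card A ^ Suc K" for i
  proof -
    have "card (?\<B> i) \<le> card {B. B \<subseteq> A \<and> card B = Suc K}"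
      using fin by (intro card_mono) auto
    also have "\<dots> = card A choose Suc K"
      using fin by (rule n_subsets)
    also have "\<dots> \<le> card A ^ Suc K"
      by (cases "Suc K \<le> card A") (auto intro: binomial_le_pow simp del: power_Suc simp: binomial_eq_0)
    finally show ?thesis .
  qed
  have "measure_pmf.prob (table_pmf c s r) {T. K ^ c * card (tab_hash c T ` A) < card A}
      \<le> measure_pmf.prob (table_pmf c s r)
          {T. \<exists>p\<in>?S. \<forall>x\<in>snd (fst p). tab_hash c T x = snd p}"
  proof (rule prob_table_pmf_mono)
    fix T assume T: "T \<in> tables c s r" "K ^ c * card (tab_hash c T ` A) < card A"
    obtain y where y: "y \<in> tab_hash c T ` A" "K ^ c < card {x \<in> A. tab_hash c T x = y}"
      using card_le_mult_card_image[OF fin, of "tab_hash c T" "K ^ c"] T(2) by force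
    have "y < 2 ^ r"
      using y(1) T(1) A tab_hash_less by auto
    obtain i B where "i < c" "B \<subseteq> {x \<in> A. tab_hash c T x = y}" "card B = Suc K" "inj_on (\<lambda>x. x ! i) B"
      using ex_distinguishing_position[of "{x \<in> A. tab_hash c T x = y}" c s K] y(2) A by blast
    with \<open>y < 2 ^ r\<close> show "\<exists>p\<in>?S. \<forall>x\<in>snd (fst p). tab_hash c T x = snd p"
      by (intro bexI[of _ "((i, B), y)"]) auto
  qed
  also have "\<dots> \<le> real (card ?S) * (1 / (2 ^ r) ^ Suc K)"
  proof (rule prob_table_pmf_Ex_le)
    show "finite ?S"
      using finB by auto
    fix p assume "p \<in> ?S"
    then obtain i B y where p: "p = ((i, B), y)" "i < c" "B \<subseteq> A" "card B = Suc K" "inj_on (\<lambda>x. x ! i) B"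
      by auto
    have "measure_pmf.prob (table_pmf c s r) {T. \<forall>x\<in>B. tab_hash c T x = y} \<le> 1 / (2 ^ r) ^ card B"
      using p fin A by (intro prob_all_in_bin_le[where i = i]) (auto intro: finite_subset)
    then show "measure_pmf.prob (table_pmf c s r) {T. \<forall>x\<in>snd (fst p). tab_hash c T x = snd p}
        \<le> 1 / (2 ^ r) ^ Suc K"
      using p by simp
  qed
  also have "\<dots> \<le> (real c * real (card A) ^ Suc K * 2 ^ r) * (1 / (2 ^ r) ^ Suc K)"
  proof (rule mult_right_mono)
    have "card ?S = (\<Sum>i<c. card (?\<B> i)) * 2 ^ r"
      using finB by (simp add: card_cartesian_product)
    also have "\<dots> \<le> (\<Sum>i<c. card A ^ Suc K) * 2 ^ r"
      using cardB by (intro mult_right_mono sum_mono) auto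
    finally have "card ?S \<le> c * card A ^ Suc K * 2 ^ r"
      by simp
    from of_nat_mono[OF this, where 'a = real]
    show "real (card ?S) \<le> real c * real (card A) ^ Suc K * 2 ^ r"
      by simp
  qed simp
  also have "\<dots> = real c * real (card A) ^ Suc K / (2 ^ r) ^ K"
    by (simp add: field_simps)
  finally show ?thesis .
qed

section \<open>The number of empty bins\<close>

lemma exp_minus_le_linear:
  fixes z :: real
  assumes "0 \<le> z" "z \<le> 1"
  shows "exp (- z) \<le> 1 - z / 2"
proof -
  have "z * z \<le> 1 * z"
    using assms by (intro mult_right_mono) auto
  then have "1 \<le> (1 - z / 2) * (1 + z)"
    by (simp add: algebra_simps)
  also have "\<dots> \<le> (1 - z / 2) * exp z"
    using assms exp_ge_add_one_self by (intro mult_left_mono) auto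
  finally show ?thesis
    by (simp add: exp_minus field_simps)
qed

text \<open>\<open>(1 - Y / L) powr t\<close> is at most \<open>exp (- (t * Y / L))\<close>, whose
  exponent lies in [-1, 0], where exp has a linear upper bound. Linearity in \<open>Y\<close>
  matters: averaging over translates then needs only the mean of \<open>Y\<close>.\<close>

lemma powr_diff_le_linear:
  fixes L Y t :: real
  assumes "L > 0" "t > 0" "0 \<le> Y" "Y \<le> L" "t * Y \<le> L"
  shows "(L - Y) powr t \<le> L powr t * (1 - t * Y / (2 * L))"
proof (cases "Y = L")
  case True
  have "0 \<le> 1 - t * Y / (2 * L)"
    using assms by (simp add: field_simps)
  then show ?thesis
    using True assms by simp
next
  case False
  then have pos: "0 < 1 - Y / L"
    using assms by (simp add: field_simps)
  have "L - Y = L * (1 - Y / L)"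
    using assms by (simp add: field_simps)
  then have "(L - Y) powr t = L powr t * (1 - Y / L) powr t"
    using pos assms by (metis less_imp_le powr_mult)
  also have "(1 - Y / L) powr t \<le> exp (- (t * Y / L))"
  proof -
    have "t * ln (1 - Y / L) \<le> t * (- (Y / L))"
      using assms(2) ln_le_minus_one[OF pos] by (intro mult_left_mono) auto
    then show ?thesis
      using pos by (simp add: powr_def)
  qed
  also have "\<dots> \<le> 1 - (t * Y / L) / 2"
    using assms by (intro exp_minus_le_linear) (auto simp: field_simps)
  finally show ?thesis
    using assms by (simp add: mult_left_mono mult.commute)
qed

text \<open>Double counting: each pair of \<open>y\<close> in \<open>S\<close> and \<open>e\<close>
  in \<open>E\<close> is matched by exactly one translation, \<open>v = xor e y\<close>.\<close>

lemma sum_card_xor_translates: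
  assumes "S \<subseteq> {..<2 ^ r :: nat}" "E \<subseteq> {..<2 ^ r :: nat}"
  shows "(\<Sum>v<2 ^ r. card ((\<lambda>y. xor y v) ` S \<inter> E)) = card S * card E"
proof -
  have fin: "finite S" "finite E"
    using assms by (auto intro: finite_subset)
  have "card ((\<lambda>y. xor y v) ` S \<inter> E) = (\<Sum>y\<in>S. of_bool (xor y v \<in> E))" for v
  proof -
    have "(\<lambda>y. xor y v) ` S \<inter> E = (\<lambda>y. xor y v) ` {y \<in> S. xor y v \<in> E}"
      by auto
    then show ?thesis
      using fin by (simp add: card_image[OF inj_on_xor] Int_def)
  qed
  then have "(\<Sum>v<2 ^ r. card ((\<lambda>y. xor y v) ` S \<inter> E))
      = (\<Sum>y\<in>S. \<Sum>v<2 ^ r. of_bool (xor y v \<in> E))"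
    by (simp only: sum.swap[of _ S])
  also have "\<dots> = (\<Sum>y\<in>S. card E)"
  proof (rule sum.cong[OF refl])
    fix y assume y: "y \<in> S"
    have "{v. v < 2 ^ r \<and> xor y v \<in> E} = (\<lambda>e. xor e y) ` E"
    proof (intro equalityI subsetI)
      fix v assume "v \<in> {v. v < 2 ^ r \<and> xor y v \<in> E}"
      then show "v \<in> (\<lambda>e. xor e y) ` E"
        by (intro image_eqI[of _ _ "xor y v"]) (auto simp: xor.commute[of _ y])
    next
      fix v assume "v \<in> (\<lambda>e. xor e y) ` E"
      then obtain e where "e \<in> E" "v = xor e y" by auto
      then show "v \<in> {v. v < 2 ^ r \<and> xor y v \<in> E}"
        using y assms by (auto simp: xor.commute[of e y] intro!: xor_nat_less_power2)
    qed
    then show "(\<Sum>v<2 ^ r. of_bool (xor y v \<in> E)) = card E"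
      by (simp add: Int_def card_image[OF inj_on_xor])
  qed
  finally show ?thesis by simp
qed

text \<open>Let g be the least group size over all positions and keys. At each position, g times the
  number of characters is at most \<open>card X\<close>. Multiplying over the positions and bounding
  the product of the character counts below by \<open>card X\<close> gives
  \<open>card X * g ^ c <= card X ^ c\<close>.\<close>

lemma ex_small_group:
  assumes X: "X \<subseteq> keys c s" "X \<noteq> {}" and c: "c \<ge> 1"
  obtains i x where "i < c" "x \<in> X" "card {z \<in> X. z ! i = x ! i} ^ c \<le> card X ^ (c - 1)"
proof -
  have fin: "finite X"
    using X finite_keys by (blast intro: finite_subset)
  let ?g = "\<lambda>(i, x). card {z \<in> X. z ! i = x ! i}"
  obtain p where p: "p \<in> {..<c} \<times> X" "\<forall>q\<in>{..<c} \<times> X. ?g p \<le> ?g q"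
  proof -
    have "finite ({..<c} \<times> X)" "{..<c} \<times> X \<noteq> {}"
      using X(2) c fin by (auto simp: lessThan_empty_iff)
    then have "\<exists>p. is_arg_min ?g (\<lambda>p. p \<in> {..<c} \<times> X) p"
      by (rule ex_is_arg_min_if_finite)
    then show ?thesis
      using that unfolding is_arg_min_linorder by blast
  qed
  obtain i x where ix: "p = (i, x)" "i < c" "x \<in> X"
    using p(1) by auto
  have "card ((\<lambda>z. z ! j) ` X) * ?g p \<le> card X" if "j < c" for j
  proof -
    have "card ((\<lambda>z. z ! j) ` X) * ?g p = (\<Sum>a\<in>(\<lambda>z. z ! j) ` X. ?g p)"
      by simp
    also have "\<dots> \<le> (\<Sum>a\<in>(\<lambda>z. z ! j) ` X. card {z \<in> X. z ! j = a})"
      using p(2) that by (intro sum_mono) force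
    also have "\<dots> = card X"
      using sum.image_gen[OF fin, of "\<lambda>_. 1 :: nat" "\<lambda>z. z ! j"] by simp
    finally show ?thesis .
  qed
  then have "(\<Prod>j<c. card ((\<lambda>z. z ! j) ` X) * ?g p) \<le> (\<Prod>j<c. card X)"
    by (intro prod_mono) auto
  then have "(\<Prod>j<c. card ((\<lambda>z. z ! j) ` X)) * ?g p ^ c \<le> card X ^ c"
    by (simp add: prod.distrib)
  moreover have "card X * ?g p ^ c \<le> (\<Prod>j<c. card ((\<lambda>z. z ! j) ` X)) * ?g p ^ c"
    using card_le_prod_characters[OF X(1)] by (rule mult_right_mono) simp
  moreover have "card X ^ c = card X * card X ^ (c - 1)"
    using c by (cases c) auto
  ultimately have "card X * ?g p ^ c \<le> card X * card X ^ (c - 1)"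
    by linarith
  moreover have "card X > 0"
    using fin X by (simp add: card_gt_0_iff)
  ultimately have "?g p ^ c \<le> card X ^ (c - 1)"
    by simp
  with ix show ?thesis
    by (intro that[of i x]) auto
qed

lemma le_powr_of_power_le:
  fixes g m c :: nat
  assumes "g ^ c \<le> m ^ (c - 1)" "c \<ge> 1" "m \<ge> 1"
  shows "real g \<le> real m powr (1 - 1 / real c)"
proof -
  have "real g ^ c \<le> real m ^ (c - 1)"
    using assms(1) by (metis of_nat_le_iff of_nat_power)
  also have "\<dots> = real m powr real (c - 1)"
    using assms by (subst powr_realpow) auto
  also have "real (c - 1) = (1 - 1 / real c) * real c"
    using assms by (simp add: field_simps of_nat_diff)
  also have "real m powr \<dots> = (real m powr (1 - 1 / real c)) ^ c"
    using assms by (simp add: powr_powr[symmetric] powr_realpow)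
  finally show ?thesis
    using assms by (subst (asm) power_mono_iff) auto
qed

text \<open>One peeling step: \<open>H\<close> is occupied by the remaining keys and
  \<open>S\<close> is the image of the group before translation. With L empty bins, a random
  translate of \<open>S\<close> fills \<open>card S * L / 2 ^ r\<close> of them on average, and
  \<open>small\<close> keeps the linear bound on the power applicable.\<close>

lemma sum_powr_empty_bins_le:
  fixes t :: real
  assumes S: "S \<subseteq> {..<2 ^ r :: nat}" and H: "H \<subseteq> {..<2 ^ r :: nat}"
    and t: "t > 0" and H': "card H < 2 ^ r"
    and small: "t \<le> 1 \<or> t * real (card S) \<le> 2 ^ r - real (card H)"
  shows "(\<Sum>v<2 ^ r. (2 ^ r - real (card (H \<union> (\<lambda>y. xor y v) ` S))) powr t)
     \<le> 2 ^ r * ((2 ^ r - real (card H)) powr t * exp (- t * real (card S) / (2 * 2 ^ r)))"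
proof -
  define E where "E = {..<2 ^ r} - H"
  define L where "L = 2 ^ r - real (card H)"
  define Y where "Y v = real (card ((\<lambda>y. xor y v) ` S \<inter> E))" for v
  have fin: "finite H" "finite S"
    using S H by (auto intro: finite_subset)
  have cardE: "real (card E) = L"
    using H fin H' by (simp add: E_def L_def card_Diff_subset of_nat_diff)
  have L: "L > 0"
    using H' unfolding L_def by simp
  have "(2 ^ r - real (card (H \<union> (\<lambda>y. xor y v) ` S))) powr t
       \<le> L powr t * (1 - t * Y v / (2 * L))" if v: "v < 2 ^ r" for v
  proof -
    have "H \<union> (\<lambda>y. xor y v) ` S = H \<union> ((\<lambda>y. xor y v) ` S \<inter> E)"
      using S v by (auto simp: E_def xor_nat_less_power2 subset_eq)
    moreover have "card (H \<union> ((\<lambda>y. xor y v) ` S \<inter> E)) = card H + card ((\<lambda>y. xor y v) ` S \<inter> E)"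
      using fin by (intro card_Un_disjoint) (auto simp: E_def)
    ultimately have eq: "2 ^ r - real (card (H \<union> (\<lambda>y. xor y v) ` S)) = L - Y v"
      by (simp add: L_def Y_def)
    have "card ((\<lambda>y. xor y v) ` S \<inter> E) \<le> card E"
      by (intro card_mono) (auto simp: E_def)
    then have YL: "Y v \<le> L"
      by (simp add: Y_def flip: cardE)
    have "card ((\<lambda>y. xor y v) ` S \<inter> E) \<le> card ((\<lambda>y. xor y v) ` S)"
      using fin by (intro card_mono) auto
    also have "\<dots> \<le> card S"
      using fin(2) by (rule card_image_le)
    finally have YS: "Y v \<le> real (card S)"
      by (simp add: Y_def)
    have Y0: "0 \<le> Y v" by (simp add: Y_def)
    have "t * Y v \<le> L"
      using small
    proof
      assume "t \<le> 1"
      then have "t * Y v \<le> 1 * Y v"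
        using Y0 by (rule mult_right_mono)
      with YL show ?thesis by simp
    next
      assume "t * real (card S) \<le> 2 ^ r - real (card H)"
      moreover have "t * Y v \<le> t * real (card S)"
        using YS t by (intro mult_left_mono) auto
      ultimately show ?thesis by (simp add: L_def)
    qed
    then show ?thesis
      unfolding eq using L t Y0 YL by (intro powr_diff_le_linear) auto
  qed
  then have "(\<Sum>v<2 ^ r. (2 ^ r - real (card (H \<union> (\<lambda>y. xor y v) ` S))) powr t)
      \<le> (\<Sum>v<2 ^ r :: nat. L powr t * (1 - t * Y v / (2 * L)))"
    by (intro sum_mono) auto
  also have "\<dots> = L powr t * (2 ^ r - t * (\<Sum>v<2 ^ r. Y v) / (2 * L))"
    by (simp add: sum_subtractf flip: sum_distrib_left sum_divide_distrib)
  also have "(\<Sum>v<2 ^ r. Y v) = real (card S) * L"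
  proof -
    have "(\<Sum>v<2 ^ r. Y v) = real (\<Sum>v<2 ^ r. card ((\<lambda>y. xor y v) ` S \<inter> E))"
      by (simp add: Y_def)
    also have "\<dots> = real (card S * card E)"
      using S by (subst sum_card_xor_translates) (auto simp: E_def)
    finally show ?thesis using cardE by simp
  qed
  also have "L powr t * (2 ^ r - t * (real (card S) * L) / (2 * L))
      = 2 ^ r * (L powr t * (1 + (- t * real (card S) / (2 * 2 ^ r))))"
    using L by (simp add: field_simps)
  also have "\<dots> \<le> 2 ^ r * (L powr t * exp (- t * real (card S) / (2 * 2 ^ r)))"
    by (intro mult_left_mono exp_ge_add_one_self) auto
  finally show ?thesis
    by (simp add: L_def)
qed

text \<open>The potential is the \<open>t\<close>-th power of the number of empty bins, cut off where that number
  is below \<open>\<theta>\<close> or where one of the peeled groups occupies too few bins. Peeling a group \<open>G\<close> of keys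
  sharing a character \<open>\<alpha>\<close> leaves keys whose hashes do not depend on the table entry at \<open>\<alpha>\<close>, which
  translates \<open>h(G)\<close> uniformly.\<close>

lemma potential_le:
  fixes \<theta> t d M :: real
  assumes X: "X \<subseteq> keys c s" and c: "c \<ge> 1" and pos: "\<theta> > 0" "t > 0" "d > 0"
    and small: "t \<le> 1 \<or> t * M \<le> \<theta>" and M: "real (card X) powr (1 - 1 / real c) \<le> M"
  shows "\<exists>\<G>. finite \<G> \<and> card \<G> \<le> card X \<and> (\<forall>G\<in>\<G>. G \<subseteq> X \<and> real (card G) \<le> M) \<and>
     (\<Sum>T\<in>tables c s r.
        of_bool (\<forall>G\<in>\<G>. real (card G) \<le> d * real (card (tab_hash c T ` G))) *
        of_bool (\<theta> \<le> 2 ^ r - real (card (tab_hash c T ` X))) *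
        (2 ^ r - real (card (tab_hash c T ` X))) powr t)
     \<le> real (card (tables c s r)) * ((2 ^ r) powr t * exp (- t * real (card X) / (2 * d * 2 ^ r)))"
  using X M
proof (induction "card X" arbitrary: X rule: less_induct)
  case (less X)
  have fin: "finite X"
    using less.prems(1) finite_keys by (rule finite_subset)
  show ?case
  proof (cases "X = {}")
    case True
    have "(\<Sum>T\<in>tables c s r. of_bool (\<theta> \<le> 2 ^ r) * (2 ^ r) powr t)
       \<le> (\<Sum>T\<in>tables c s r. (2 ^ r) powr t)"
      by (intro sum_mono) auto
    then show ?thesis
      using True by (intro exI[of _ "{}"]) simp
  next
    case False
    obtain i x where ix: "i < c" "x \<in> X"
      and gc: "card {z \<in> X. z ! i = x ! i} ^ c \<le> card X ^ (c - 1)"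
      using ex_small_group[OF less.prems(1) False c] .
    define G where "G = {z \<in> X. z ! i = x ! i}"
    define X' where "X' = X - G"
    have GX: "G \<subseteq> X" "G \<union> X' = X" "card X = card G + card X'" "card X' < card X"
    proof -
      show "G \<subseteq> X" by (auto simp: G_def)
      then show 1: "card X = card G + card X'"
        using fin unfolding X'_def by (metis card_Diff_subset card_mono finite_subset le_add_diff_inverse)
      have "card G > 0"
        using ix fin by (auto simp: G_def card_gt_0_iff)
      with 1 show "card X' < card X" by simp
    qed (auto simp: G_def X'_def)
    have "card X \<ge> 1"
      using fin False by (simp add: Suc_le_eq card_gt_0_iff)
    then have "real (card G) \<le> real (card X) powr (1 - 1 / real c)"
      using gc c by (intro le_powr_of_power_le) (auto simp: G_def)
    with less.prems have GM: "real (card G) \<le> M" by simp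
    have "real (card X') powr (1 - 1 / real c) \<le> real (card X) powr (1 - 1 / real c)"
      using c GX by (intro powr_mono2) auto
    with less.prems have M': "real (card X') powr (1 - 1 / real c) \<le> M" by simp
    have X': "X' \<subseteq> keys c s"
      using less.prems by (auto simp: X'_def)
    have xi: "x ! i < s"
      using ix less.prems by (auto simp: keys_def)
    define h where "h = tab_hash c"
    define good where "good \<G> T \<longleftrightarrow> (\<forall>G\<in>\<G>. real (card G) \<le> d * real (card (h T ` G)))" for \<G> T
    define L where "L Z T = 2 ^ r - real (card (h T ` Z))" for Z T
    define e where "e m = exp (- t * m / (2 * d * 2 ^ r))" for m :: real
    obtain \<G> where \<G>: "finite \<G>" "card \<G> \<le> card X'" "\<forall>G\<in>\<G>. G \<subseteq> X' \<and> real (card G) \<le> M"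
      and IH: "(\<Sum>T\<in>tables c s r. of_bool (good \<G> T) * of_bool (\<theta> \<le> L X' T) * L X' T powr t)
        \<le> real (card (tables c s r)) * ((2 ^ r) powr t * e (real (card X')))"
      using less.hyps[OF GX(4) X' M'] unfolding good_def L_def e_def h_def by blast
    let ?\<G> = "insert G \<G>"
    let ?F = "\<lambda>T. of_bool (good ?\<G> T) * of_bool (\<theta> \<le> L X T) * L X T powr t"
    have step: "(\<Sum>v<2 ^ r. ?F (shift_entry (i, x ! i) v T))
        \<le> 2 ^ r * (of_bool (good \<G> T) * of_bool (\<theta> \<le> L X' T) * L X' T powr t * e (real (card G)))"
      if T: "T \<in> tables c s r" for T
    proof -
      let ?T = "\<lambda>v. shift_entry (i, x ! i) v T"
      have hX': "h (?T v) ` Z = h T ` Z" if "Z \<subseteq> X'" for v Z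
        using that by (intro image_cong) (auto simp: h_def tab_hash_shift_entry X'_def G_def)
      have hG: "h (?T v) ` G = (\<lambda>y. xor y v) ` h T ` G" for v
        using ix by (auto simp: h_def tab_hash_shift_entry G_def image_image intro!: image_cong)
      have card_hG: "card (h (?T v) ` G) = card (h T ` G)" for v
        unfolding hG by (rule card_image[OF inj_on_xor])
      have good: "good ?\<G> (?T v) \<longleftrightarrow> good \<G> T \<and> real (card G) \<le> d * real (card (h T ` G))" for v
        using \<G>(3) hX' by (auto simp: good_def card_hG)
      have sub: "h T ` Z \<subseteq> {..<2 ^ r}" if "Z \<subseteq> X" for Z
        using that less.prems(1) T tab_hash_less by (fastforce simp: h_def)
      have LX: "L X (?T v) = 2 ^ r - real (card (h T ` X' \<union> (\<lambda>y. xor y v) ` h T ` G))" for v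
        using GX(2) hX'[of X'] hG by (metis L_def image_Un subset_refl sup_commute)
      have LX_le: "L X (?T v) \<le> L X' T" for v
        unfolding LX unfolding L_def using fin
        by (simp add: X'_def G_def, intro card_mono) auto
      show ?thesis
      proof (cases "good \<G> T \<and> real (card G) \<le> d * real (card (h T ` G)) \<and> \<theta> \<le> L X' T")
        case True
        have "(\<Sum>v<2 ^ r. ?F (?T v))
            \<le> (\<Sum>v<2 ^ r. (2 ^ r - real (card (h T ` X' \<union> (\<lambda>y. xor y v) ` h T ` G))) powr t)"
          by (intro sum_mono) (auto simp: LX)
        also have "\<dots> \<le> 2 ^ r * ((2 ^ r - real (card (h T ` X'))) powr t *
            exp (- t * real (card (h T ` G)) / (2 * 2 ^ r)))"
        proof (rule sum_powr_empty_bins_le)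
          have "real (card (h T ` X')) < 2 ^ r"
            using True pos unfolding L_def by linarith
          then show "card (h T ` X') < 2 ^ r"
            by simp
          have "card (h T ` G) \<le> card G"
            using fin by (intro card_image_le) (auto simp: G_def)
          then have "t * real (card (h T ` G)) \<le> t * M"
            using pos GM by (intro mult_left_mono) auto
          then show "t \<le> 1 \<or> t * real (card (h T ` G)) \<le> 2 ^ r - real (card (h T ` X'))"
            using small True by (auto simp: L_def)
        qed (use sub GX X'_def pos in auto)
        \<comment> \<open>Goodness of \<open>G\<close> replaces the number of occupied bins by
          \<open>card G / d\<close>, making the decay factor independent of
          \<open>T\<close>.\<close>
        also have "\<dots> \<le> 2 ^ r * (L X' T powr t * e (real (card G)))"
        proof -
          have "t * real (card G) / (2 * d * 2 ^ r) \<le> t * (d * real (card (h T ` G))) / (2 * d * 2 ^ r)"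
            using True pos by (intro divide_right_mono mult_left_mono) auto
          also have "\<dots> = t * real (card (h T ` G)) / (2 * 2 ^ r)"
            using pos by simp
          finally show ?thesis
            unfolding e_def L_def by (intro mult_left_mono) auto
        qed
        finally show ?thesis using True by simp
      next
        case False
        have "?F (?T v) = 0" for v
          using False LX_le[of v] by (auto simp: good)
        then have "(\<Sum>v<2 ^ r. ?F (?T v)) = 0" by (intro sum.neutral) blast
        also have "0 \<le> 2 ^ r * (of_bool (good \<G> T) * of_bool (\<theta> \<le> L X' T) * L X' T powr t * e (real (card G)))"
          by (simp add: e_def)
        finally show ?thesis .
      qed
    qed
    have "2 ^ r * (\<Sum>T\<in>tables c s r. ?F T) = (\<Sum>T\<in>tables c s r. \<Sum>v<2 ^ r. ?F (shift_entry (i, x ! i) v T))"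
      using ix xi by (intro sum_tables_shift_entry)
    also have "\<dots> \<le> (\<Sum>T\<in>tables c s r. 2 ^ r * (of_bool (good \<G> T) * of_bool (\<theta> \<le> L X' T) * L X' T powr t * e (real (card G))))"
      using step by (rule sum_mono)
    also have "\<dots> = 2 ^ r * ((\<Sum>T\<in>tables c s r. of_bool (good \<G> T) * of_bool (\<theta> \<le> L X' T) * L X' T powr t) * e (real (card G)))"
      by (simp only: sum_distrib_left sum_distrib_right)
    also have "\<dots> \<le> 2 ^ r * (real (card (tables c s r)) * ((2 ^ r) powr t * e (real (card X'))) * e (real (card G)))"
      using IH by (intro mult_left_mono mult_right_mono) (auto simp: e_def)
    also have "\<dots> = 2 ^ r * (real (card (tables c s r)) * ((2 ^ r) powr t * e (real (card X))))"
    proof -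
      have "e (real (card X)) = e (real (card X')) * e (real (card G))"
        unfolding e_def GX(3) by (simp flip: exp_add add: distrib_left add_divide_distrib diff_divide_distrib)
      then show ?thesis by simp
    qed
    finally have "(\<Sum>T\<in>tables c s r. ?F T) \<le> real (card (tables c s r)) * ((2 ^ r) powr t * e (real (card X)))"
      by simp
    moreover have "card ?\<G> \<le> card X"
    proof -
      have "card ?\<G> \<le> Suc (card \<G>)"
        by (rule card_insert_le_m1) auto
      with \<G>(2) GX(4) show ?thesis by simp
    qed
    moreover have "\<forall>A\<in>?\<G>. A \<subseteq> X \<and> real (card A) \<le> M"
      using \<G>(3) GM by (auto simp: G_def X'_def)
    ultimately show ?thesis
      using \<G>(1) unfolding good_def L_def e_def h_def by (intro exI[of _ ?\<G>]) auto
  qed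
qed

text \<open>The peeled groups depend on \<open>X\<close> but not on the table, so a union bound over
  at most \<open>card X\<close> of them handles overloading. On the remaining tables, Markov's
  inequality applies to the truncated potential.\<close>

lemma prob_many_empty_bins_le:
  fixes \<theta> t d M p :: real
  assumes X: "X \<subseteq> keys c s" and c: "c \<ge> 1" and pos: "\<theta> > 0" "t > 0" "d > 0"
    and small: "t \<le> 1 \<or> t * M \<le> \<theta>" and M: "real (card X) powr (1 - 1 / real c) \<le> M"
    and load: "\<And>G. G \<subseteq> keys c s \<Longrightarrow> real (card G) \<le> M \<Longrightarrow>
      measure_pmf.prob (table_pmf c s r) {T. d * real (card (tab_hash c T ` G)) < real (card G)} \<le> p"
    and p: "p \<ge> 0"
  shows "measure_pmf.prob (table_pmf c s r) {T. \<theta> \<le> 2 ^ r - real (card (tab_hash c T ` X))}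
     \<le> real (card X) * p + (2 ^ r / \<theta>) powr t * exp (- t * real (card X) / (2 * d * 2 ^ r))"
proof -
  let ?P = "\<lambda>Q. measure_pmf.prob (table_pmf c s r) {T. Q T}"
  define L where "L T = 2 ^ r - real (card (tab_hash c T ` X))" for T
  obtain \<G> where \<G>: "finite \<G>" "card \<G> \<le> card X" "\<forall>G\<in>\<G>. G \<subseteq> X \<and> real (card G) \<le> M"
    and sum: "(\<Sum>T\<in>tables c s r.
        of_bool (\<forall>G\<in>\<G>. real (card G) \<le> d * real (card (tab_hash c T ` G))) *
        of_bool (\<theta> \<le> L T) * L T powr t)
     \<le> real (card (tables c s r)) * ((2 ^ r) powr t * exp (- t * real (card X) / (2 * d * 2 ^ r)))"
    using potential_le[OF X c pos small M, of r] unfolding L_def by blast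
  let ?good = "\<lambda>T. \<forall>G\<in>\<G>. real (card G) \<le> d * real (card (tab_hash c T ` G))"
  have "?P (\<lambda>T. \<theta> \<le> L T) \<le> measure_pmf.prob (table_pmf c s r)
     ({T. \<exists>G\<in>\<G>. d * real (card (tab_hash c T ` G)) < real (card G)} \<union> {T. ?good T \<and> \<theta> \<le> L T})"
    by (intro measure_pmf.finite_measure_mono) (auto simp: not_le[symmetric])
  also have "\<dots> \<le> ?P (\<lambda>T. \<exists>G\<in>\<G>. d * real (card (tab_hash c T ` G)) < real (card G))
      + ?P (\<lambda>T. ?good T \<and> \<theta> \<le> L T)"
    by (intro measure_subadditive) auto
  also have "?P (\<lambda>T. \<exists>G\<in>\<G>. d * real (card (tab_hash c T ` G)) < real (card G)) \<le> real (card \<G>) * p"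
    using \<G> X by (intro prob_table_pmf_Ex_le load) auto
  also have "\<dots> \<le> real (card X) * p"
    using \<G>(2) p by (intro mult_right_mono) auto
  also have "?P (\<lambda>T. ?good T \<and> \<theta> \<le> L T) \<le> (2 ^ r / \<theta>) powr t * exp (- t * real (card X) / (2 * d * 2 ^ r))"
  proof -
    have "real (card {T \<in> tables c s r. ?good T \<and> \<theta> \<le> L T}) * \<theta> powr t
        = (\<Sum>T\<in>tables c s r. of_bool (?good T) * of_bool (\<theta> \<le> L T) * \<theta> powr t)"
      by (simp add: Int_def flip: sum_distrib_right of_bool_conj)
    also have "\<dots> \<le> (\<Sum>T\<in>tables c s r. of_bool (?good T) * of_bool (\<theta> \<le> L T) * L T powr t)"
      using pos by (intro sum_mono) (auto intro: powr_mono2)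
    also note sum
    finally show ?thesis
      unfolding prob_table_pmf using pos by (simp add: powr_divide field_simps)
  qed
  finally show ?thesis by (simp add: L_def)
qed

section \<open>Choice of parameters\<close>

lemma exp_le_one_minus_powr:
  fixes n a :: real
  assumes "n \<ge> 2" "a \<ge> 0"
  shows "exp (- 2 * a / n) \<le> (1 - 1 / n) powr a"
proof -
  have "exp (- (2 / n)) \<le> 1 - (2 / n) / 2"
    using assms by (intro exp_minus_le_linear) auto
  then have "exp (- (2 / n)) powr a \<le> (1 - 1 / n) powr a"
    using assms by (intro powr_mono2) auto
  then show ?thesis
    by (simp add: exp_powr_real algebra_simps)
qed

text \<open>With n = \<open>2 ^ r\<close>, the exponent of n is
  \<open>1 - \<epsilon> - \<epsilon> * K\<close>, and \<open>\<epsilon> * K >= \<gamma> + 3\<close>.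
  The surplus of 2 in the result pays for the union bound over the groups.\<close>

lemma prob_overloaded_powr_le:
  fixes \<epsilon> \<gamma> :: real
  assumes G: "G \<subseteq> keys c s" "real (card G) \<le> (2 ^ r) powr (1 - \<epsilon>)"
    and \<epsilon>: "\<epsilon> > 0" and K: "real K \<ge> (\<gamma> + 3) / \<epsilon>"
  shows "measure_pmf.prob (table_pmf c s r)
      {T. real (K ^ c) * real (card (tab_hash c T ` G)) < real (card G)}
    \<le> real c * (2 ^ r) powr (- \<gamma> - 2)"
proof -
  have "real (K ^ c) * real (card (tab_hash c T ` G)) < real (card G) \<longleftrightarrow>
      K ^ c * card (tab_hash c T ` G) < card G" for T
    by (metis of_nat_less_iff of_nat_mult)
  then have "measure_pmf.prob (table_pmf c s r)
      {T. real (K ^ c) * real (card (tab_hash c T ` G)) < real (card G)}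
    \<le> real c * real (card G) ^ Suc K / (2 ^ r) ^ K"
    using prob_overloaded_le[OF G(1), of r K] by simp
  also have "\<dots> \<le> real c * ((2 ^ r) powr (1 - \<epsilon>)) ^ Suc K / (2 ^ r) ^ K"
    using G(2) by (intro divide_right_mono mult_left_mono power_mono) auto
  also have "((2 ^ r) powr (1 - \<epsilon>)) ^ Suc K = (2 ^ r :: real) powr ((1 - \<epsilon>) * real (Suc K))"
    by (subst powr_realpow[symmetric]) (simp_all only: powr_powr, simp)
  also have "(2 ^ r :: real) ^ K = (2 ^ r) powr real K"
    by (simp add: powr_realpow)
  also have "real c * (2 ^ r) powr ((1 - \<epsilon>) * real (Suc K)) / (2 ^ r) powr real K
      = real c * (2 ^ r) powr ((1 - \<epsilon>) * real (Suc K) - real K)"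
    by (simp add: powr_diff)
  also have "\<dots> \<le> real c * (2 ^ r) powr (- \<gamma> - 2)"
  proof (intro mult_left_mono powr_mono)
    have "\<gamma> + 3 \<le> \<epsilon> * real K"
      using K \<epsilon> by (simp add: field_simps)
    then show "(1 - \<epsilon>) * real (Suc K) - real K \<le> - \<gamma> - 2"
      using \<epsilon> by (simp add: algebra_simps)
  qed auto
  finally show ?thesis .
qed

text \<open>The first part keeps key sets of size about \<open>\<kappa> * n * ln n\<close> below
  \<open>n powr (1 + \<epsilon>)\<close>, the 1 absorbing a ceiling; the second bounds the Markov
  term in the middle range of \<open>m\<close>.\<close>

lemma eventually_parameters:
  fixes \<kappa> \<epsilon> d \<gamma> :: real
  assumes "\<epsilon> > 0" "d > 0" "\<gamma> > 0" "\<kappa> > 0"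
  shows "\<forall>\<^sub>F x in at_top. \<kappa> * x * ln x + 1 \<le> x powr (1 + \<epsilon>) \<and>
           exp (- (x powr (\<epsilon> / 2)) / (4 * d)) \<le> x powr (- \<gamma>)"
proof (intro eventually_conj)
  show "\<forall>\<^sub>F x in at_top. \<kappa> * x * ln x + 1 \<le> x powr (1 + \<epsilon>)"
    using assms by real_asymp
  show "\<forall>\<^sub>F x in at_top. exp (- (x powr (\<epsilon> / 2)) / (4 * d)) \<le> x powr (- \<gamma>)"
    using assms by real_asymp
qed

theorem theorem2:
  fixes c :: nat and \<gamma> :: real
  assumes "c \<ge> 1" and "\<gamma> > 0"
  shows "\<exists>\<beta>::real. \<beta> > 0 \<and> (\<exists>C::real. \<forall>(s::nat) (r::nat) (X::nat list set).
           X \<subseteq> keys c s \<longrightarrow>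
           measure_pmf.prob (table_pmf c s r)
             {T. real (card (tab_hash c T ` X))
                   < real (2^r) * (1 - (1 - 1 / real (2^r)) powr (real (card X) / \<beta>))}
           \<le> C * real (2^r) powr (- \<gamma>))"
proof -
  define \<epsilon> where "\<epsilon> = 1 / (2 * real c)"
  define K where "K = nat \<lceil>(\<gamma> + 3) / \<epsilon>\<rceil>"
  define d where "d = real (K ^ c)"
  \<comment> \<open>\<open>\<kappa>\<close> makes
    \<open>n * exp (- \<kappa> * n * ln n / (2 * d * n))\<close> equal to
    \<open>n powr (- \<gamma>)\<close>. In \<open>\<beta>\<close>, the first summand keeps
    \<open>2 / \<beta>\<close> below half the decay rate \<open>1 / (2 * d)\<close>; the second
    keeps \<open>\<theta> / n\<close> above \<open>n powr (- \<epsilon> / 2)\<close> in the middle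
    range.\<close>
  define \<kappa> where "\<kappa> = 2 * d * (\<gamma> + 1)"
  define \<beta> where "\<beta> = 8 * d + 4 * \<kappa> / \<epsilon>"
  have \<epsilon>: "\<epsilon> > 0" "\<epsilon> \<le> 1 / 2" and c\<epsilon>: "1 / real c = 2 * \<epsilon>"
    using assms(1) by (auto simp: \<epsilon>_def field_simps)
  have K: "real K \<ge> (\<gamma> + 3) / \<epsilon>"
    unfolding K_def by (rule real_nat_ceiling_ge)
  moreover have "(\<gamma> + 3) / \<epsilon> > 0"
    using assms \<epsilon> by simp
  ultimately have "real K > 0" by linarith
  then have d: "d > 0"
    by (simp add: d_def)
  have \<kappa>: "\<kappa> > 0"
    using d assms by (simp add: \<kappa>_def)
  have \<beta>: "\<beta> > 0" "\<beta> \<ge> 8 * d" "\<beta> \<ge> 4 * \<kappa> / \<epsilon>"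
    using d \<kappa> \<epsilon> by (auto simp: \<beta>_def intro!: add_pos_pos)
  obtain N where N: "\<And>x. x \<ge> N \<Longrightarrow> \<kappa> * x * ln x + 1 \<le> x powr (1 + \<epsilon>)"
      "\<And>x. x \<ge> N \<Longrightarrow> exp (- (x powr (\<epsilon> / 2)) / (4 * d)) \<le> x powr (- \<gamma>)"
    using eventually_parameters[OF \<epsilon>(1) d assms(2) \<kappa>] unfolding eventually_at_top_linorder by blast
  define N' where "N' = max N 2"
  \<comment> \<open>The summands pay for overloaded groups, for the Markov term, and for the bounded
    values \<open>n < N'\<close>, where the trivial bound 1 suffices.\<close>
  define C where "C = real c + 1 + N' powr \<gamma>"
  have "measure_pmf.prob (table_pmf c s r)
      {T. real (card (tab_hash c T ` X))
            < real (2^r) * (1 - (1 - 1 / real (2^r)) powr (real (card X) / \<beta>))}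
      \<le> C * real (2^r) powr (- \<gamma>)"
    if X: "X \<subseteq> keys c s" for s r X
  proof -
    define n :: real where "n = 2 ^ r"
    define m where "m = real (card X)"
    let ?P = "\<lambda>Q. measure_pmf.prob (table_pmf c s r) {T. Q T}"
    let ?h = "\<lambda>T Z. real (card (tab_hash c T ` Z))"
    let ?bad = "\<lambda>T. ?h T X < n * (1 - (1 - 1 / n) powr (m / \<beta>))"
    have n1: "n \<ge> 1" by (simp add: n_def)
    have "?P ?bad \<le> C * n powr (- \<gamma>)"
    proof (cases "n \<ge> N'")
      case False
      have "?P ?bad \<le> 1" by simp
      also have "1 \<le> (N' / n) powr \<gamma>"
        using False n1 assms by (intro ge_one_powr_ge_zero) (auto simp: N'_def)
      also have "\<dots> = N' powr \<gamma> * n powr (- \<gamma>)"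
        using n1 by (simp add: powr_divide powr_minus_divide N'_def)
      also have "\<dots> \<le> C * n powr (- \<gamma>)"
        by (intro mult_right_mono) (auto simp: C_def)
      finally show ?thesis .
    next
      case True
      then have n2: "n \<ge> 2" and nN: "n \<ge> N" by (auto simp: N'_def)
      define p where "p = real c * n powr (- \<gamma> - 2)"
      have p0: "p \<ge> 0" by (simp add: p_def)
      have load: "?P (\<lambda>T. d * ?h T G < real (card G)) \<le> p"
        if "G \<subseteq> keys c s" "real (card G) \<le> n powr (1 - \<epsilon>)" for G
        using prob_overloaded_powr_le[OF that(1) _ \<epsilon>(1) K, of r] that(2)
        by (simp add: n_def d_def p_def)
      have p_le: "p \<le> real c * n powr (- \<gamma>)"
        unfolding p_def using n2 by (intro mult_left_mono powr_mono) auto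
      have C_ge: "(real c + 1) * n powr (- \<gamma>) \<le> C * n powr (- \<gamma>)"
        by (intro mult_right_mono) (auto simp: C_def)
      have mp_le: "a * p \<le> real c * n powr (- \<gamma>)" if "a \<le> n powr (1 + \<epsilon>)" for a
      proof -
        have "a * p \<le> n powr (1 + \<epsilon>) * p"
          using that p0 by (rule mult_right_mono)
        also have "\<dots> = real c * n powr (1 + \<epsilon> + (- \<gamma> - 2))"
          unfolding p_def powr_add[of n "1 + \<epsilon>" "- \<gamma> - 2"] by (rule mult.left_commute)
        also have "\<dots> \<le> real c * n powr (- \<gamma>)"
          using n2 \<epsilon> by (intro mult_left_mono powr_mono) auto
        finally show ?thesis .
      qed
      \<comment> \<open>Since \<open>1 / c = 2 * \<epsilon>\<close>, the exponent is
        \<open>(1 + \<epsilon>) * (1 - 2 * \<epsilon>)\<close>, so groups peeled from up to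
        \<open>n powr (1 + \<epsilon>)\<close> keys stay polynomially smaller than
        \<open>n\<close>.\<close>
      have M_le: "a powr (1 - 1 / real c) \<le> n powr (1 - \<epsilon>)" if "0 \<le> a" "a \<le> n powr (1 + \<epsilon>)" for a
      proof -
        have "a powr (1 - 1 / real c) \<le> (n powr (1 + \<epsilon>)) powr (1 - 1 / real c)"
          using that \<epsilon> c\<epsilon> by (intro powr_mono2) auto
        also have "\<dots> = n powr ((1 + \<epsilon>) * (1 - 2 * \<epsilon>))"
          by (simp add: powr_powr c\<epsilon>)
        also have "\<dots> \<le> n powr (1 - \<epsilon>)"
          using n2 \<epsilon> by (intro powr_mono) (auto simp: algebra_simps)
        finally show ?thesis .
      qed
      have "exp (- 2 * (m / \<beta>) / n) \<le> (1 - 1 / n) powr (m / \<beta>)"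
        using n2 \<beta> by (intro exp_le_one_minus_powr) (auto simp: m_def)
      then have q_le: "exp (- (2 * m / (\<beta> * n))) \<le> (1 - 1 / n) powr (m / \<beta>)"
        by simp
      \<comment> \<open>An exponential lower bound for the number of empty bins in the bad
        event.\<close>
      define \<theta> where "\<theta> = n * exp (- (2 * m / (\<beta> * n)))"
      have \<theta>: "\<theta> > 0" using n2 by (simp add: \<theta>_def)
      have bad: "\<theta> \<le> n - ?h T X" if "?bad T" for T
      proof -
        have "\<theta> \<le> n * (1 - 1 / n) powr (m / \<beta>)"
          unfolding \<theta>_def using q_le n2 by (intro mult_left_mono) auto
        with that show ?thesis by (simp add: algebra_simps)
      qed
      consider "m \<le> n powr (1 - \<epsilon>)" | "m > n powr (1 - \<epsilon>)" "m \<le> \<kappa> * n * ln n" | "m > \<kappa> * n * ln n"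
        by linarith
      then show ?thesis
      proof cases
        case 1
        \<comment> \<open>With so few keys, \<open>X\<close> itself can serve as a group: a bad
          table has at most \<open>2 * m / \<beta> <= m / (4 * d)\<close> occupied bins and hence
          overloads \<open>X\<close>.\<close>
        have "?P ?bad \<le> ?P (\<lambda>T. d * ?h T X < real (card X))"
        proof (rule prob_table_pmf_mono, rule ccontr)
          fix T assume "?bad T" and "\<not> d * ?h T X < real (card X)"
          then have h: "m \<le> d * ?h T X" by (simp add: m_def)
          have "X \<noteq> {}"
            using \<open>?bad T\<close> n2 by (auto simp: m_def)
          then have m0: "m > 0"
            using finite_subset[OF X finite_keys] by (simp add: m_def card_gt_0_iff)
          have "n * (1 - 2 * m / (\<beta> * n)) \<le> \<theta>"
            unfolding \<theta>_def using n2 exp_ge_add_one_self[of "- (2 * m / (\<beta> * n))"]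
            by (intro mult_left_mono) auto
          then have "?h T X \<le> 2 * m / \<beta>"
            using bad[OF \<open>?bad T\<close>] n2 \<beta> by (simp add: algebra_simps)
          also have "\<dots> \<le> 2 * m / (8 * d)"
            using \<beta> m0 d by (intro divide_left_mono) auto
          finally have "d * ?h T X \<le> m / 4"
            using d by (simp add: field_simps)
          with h m0 show False by simp
        qed
        also have "\<dots> \<le> p"
          using 1 X by (intro load) (auto simp: m_def)
        also note p_le
        also have "real c * n powr (- \<gamma>) \<le> C * n powr (- \<gamma>)"
          by (intro mult_right_mono) (auto simp: C_def)
        finally show ?thesis .
      next
        case 2
        define M where "M = m powr (1 - 1 / real c)"
        \<comment> \<open>The largest exponent permitted by the condition
          \<open>t * M <= \<theta>\<close>.\<close>
        define t where "t = \<theta> / M"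
        have m0: "m > 0"
          using 2(1) by (meson powr_ge_zero le_less_trans)
        have M: "M > 0" "M \<le> n powr (1 - \<epsilon>)"
          using m0 2(2) N(1)[OF nN] M_le[of m] by (auto simp: M_def)
        have t: "t > 0" "t * M \<le> \<theta>"
          using \<theta> M by (auto simp: t_def)
        have "?P ?bad \<le> ?P (\<lambda>T. \<theta> \<le> 2 ^ r - ?h T X)"
          using bad by (intro prob_table_pmf_mono) (auto simp: n_def)
        also have "\<dots> \<le> m * p + (n / \<theta>) powr t * exp (- t * m / (2 * d * n))"
          unfolding m_def n_def
          by (rule prob_many_empty_bins_le[OF X assms(1) \<theta> t(1) d disjI2[OF t(2)] _ _ p0])
             (use load M in \<open>auto simp: M_def m_def\<close>)
        also have "m * p \<le> real c * n powr (- \<gamma>)"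
          using 2(2) N(1)[OF nN] by (intro mp_le) linarith
        also have "(n / \<theta>) powr t * exp (- t * m / (2 * d * n)) \<le> n powr (- \<gamma>)"
        proof -
          have "n / \<theta> = exp (2 * m / (\<beta> * n))"
            using n2 by (simp add: \<theta>_def exp_minus field_simps)
          \<comment> \<open>Per unit of \<open>t * m / n\<close>, the factor
            \<open>n / \<theta>\<close> costs \<open>2 / \<beta> <= 1 / (4 * d)\<close> against a
            gain of \<open>1 / (2 * d)\<close>; what remains is to show that
            \<open>t * m / n\<close> is polynomially large.\<close>
          then have "(n / \<theta>) powr t * exp (- t * m / (2 * d * n))
              = exp (t * m / n * (2 / \<beta>) - t * m / n * (1 / (2 * d)))"
            by (simp add: exp_powr_real flip: exp_add add: field_simps)
          also have "\<dots> \<le> exp (- (n powr (\<epsilon> / 2)) / (4 * d))"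
          proof -
            have "t * m / n * (2 / \<beta>) \<le> t * m / n * (2 / (8 * d))"
              using \<beta> t m0 n2 d by (intro mult_left_mono divide_left_mono) auto
            also have "\<dots> - t * m / n * (1 / (2 * d)) = - (t * m / n) / (4 * d)"
              by (simp add: field_simps)
            finally have "t * m / n * (2 / \<beta>) - t * m / n * (1 / (2 * d)) \<le> - (t * m / n) / (4 * d)"
              by simp
            \<comment> \<open>\<open>t * m / n\<close> equals \<open>\<theta> / n\<close> times
              \<open>m powr (1 / c)\<close>. The first factor is at least
              \<open>n powr (- \<epsilon> / 2)\<close>, and the second at least
              \<open>n powr \<epsilon>\<close> because
              \<open>m > n powr (1 - \<epsilon>)\<close>.\<close>
            moreover have "n powr (\<epsilon> / 2) \<le> t * m / n"
            proof -
              have "2 * m / (\<beta> * n) \<le> 2 * (\<kappa> * n * ln n) / (\<beta> * n)"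
                using 2(2) \<beta> n2 by (intro divide_right_mono) auto
              also have "\<dots> = (2 * \<kappa> / \<beta>) * ln n"
                using n2 by simp
              also have "\<dots> \<le> (\<epsilon> / 2) * ln n"
              proof (rule mult_right_mono)
                show "2 * \<kappa> / \<beta> \<le> \<epsilon> / 2"
                  using \<beta> \<epsilon> by (simp add: field_simps)
              qed (use n2 in auto)
              finally have "n powr (- (\<epsilon> / 2)) \<le> exp (- (2 * m / (\<beta> * n)))"
                using n2 by (simp add: powr_def)
              moreover have "n powr \<epsilon> \<le> m powr (2 * \<epsilon>)"
              proof -
                have "n powr \<epsilon> \<le> n powr ((1 - \<epsilon>) * (2 * \<epsilon>))"
                proof (rule powr_mono)
                  have "\<epsilon> * (2 * \<epsilon>) \<le> \<epsilon> * 1"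
                    using \<epsilon> by (intro mult_left_mono) auto
                  then show "\<epsilon> \<le> (1 - \<epsilon>) * (2 * \<epsilon>)"
                    by (simp add: algebra_simps)
                qed (use n2 in auto)
                also have "\<dots> = (n powr (1 - \<epsilon>)) powr (2 * \<epsilon>)"
                  by (simp add: powr_powr)
                also have "\<dots> \<le> m powr (2 * \<epsilon>)"
                  using 2(1) \<epsilon> by (intro powr_mono2) auto
                finally show ?thesis .
              qed
              ultimately have "n powr (- (\<epsilon> / 2)) * n powr \<epsilon> \<le> exp (- (2 * m / (\<beta> * n))) * m powr (2 * \<epsilon>)"
                by (intro mult_mono) auto
              also have "n powr (- (\<epsilon> / 2)) * n powr \<epsilon> = n powr (\<epsilon> / 2)"
                by (simp flip: powr_add)
              also have "exp (- (2 * m / (\<beta> * n))) * m powr (2 * \<epsilon>) = t * m / n"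
              proof -
                have "m = M * m powr (2 * \<epsilon>)"
                  using m0 by (simp add: M_def c\<epsilon> flip: powr_add)
                then have "m / M = m powr (2 * \<epsilon>)"
                  using M by (simp add: field_simps)
                moreover have "t * m / n = exp (- (2 * m / (\<beta> * n))) * (m / M)"
                  using n2 by (simp add: t_def \<theta>_def)
                ultimately show ?thesis by simp
              qed
              finally show ?thesis .
            qed
            then have "- (t * m / n) / (4 * d) \<le> - (n powr (\<epsilon> / 2)) / (4 * d)"
              using d by (intro divide_right_mono) auto
            ultimately show ?thesis by simp
          qed
          also have "\<dots> \<le> n powr (- \<gamma>)"
            by (rule N(2)[OF nN])
          finally show ?thesis .
        qed
        finally show ?thesis
          using C_ge by (simp add: algebra_simps)
      next
        case 3
        \<comment> \<open>\<open>X\<close> may be too large for its groups to be small, so only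
          \<open>k\<close> of its keys are used; they already fill all bins with high
          probability.\<close>
        define k where "k = nat \<lceil>\<kappa> * n * ln n\<rceil>"
        have pos: "\<kappa> * n * ln n \<ge> 0"
          using \<kappa> n2 by simp
        have k: "\<kappa> * n * ln n \<le> real k" "real k \<le> n powr (1 + \<epsilon>)"
          using N(1)[OF nN] pos by (auto simp: k_def real_nat_ceiling_ge) linarith
        have "k \<le> card X"
          using 3 unfolding k_def m_def by (simp add: ceiling_le_iff nat_le_iff)
        then obtain Z where Z: "Z \<subseteq> X" "card Z = k"
          by (meson obtain_subset_with_card_n)
        have ZK: "Z \<subseteq> keys c s" using Z X by auto
        \<comment> \<open>A bad table leaves a positive, hence integral and at least 1, number of
          bins empty; cutoff 1 and exponent 1 therefore suffice.\<close>
        have "?P ?bad \<le> ?P (\<lambda>T. 1 \<le> 2 ^ r - ?h T Z)"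
        proof (rule prob_table_pmf_mono)
          fix T assume "?bad T"
          have "card (tab_hash c T ` Z) \<le> card (tab_hash c T ` X)"
            using Z finite_subset[OF X finite_keys] by (intro card_mono) auto
          with bad[OF \<open>?bad T\<close>] \<theta> have "real (card (tab_hash c T ` Z)) < 2 ^ r"
            unfolding n_def by linarith
          then have "card (tab_hash c T ` Z) + 1 \<le> 2 ^ r"
            by simp
          from of_nat_mono[OF this, where 'a = real] show "1 \<le> 2 ^ r - ?h T Z" by simp
        qed
        also have "\<dots> \<le> real (card Z) * p + (2 ^ r / 1) powr 1 * exp (- 1 * real (card Z) / (2 * d * 2 ^ r))"
          by (rule prob_many_empty_bins_le[OF ZK assms(1) _ _ d _ order_refl _ p0])
             (use load M_le[of "real k"] k Z in auto)
        also have "real (card Z) * p \<le> real c * n powr (- \<gamma>)"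
          using k Z by (intro mp_le) auto
        also have "(2 ^ r / 1) powr 1 * exp (- 1 * real (card Z) / (2 * d * 2 ^ r)) \<le> n powr (- \<gamma>)"
        proof -
          have "(\<gamma> + 1) * ln n = \<kappa> * n * ln n / (2 * d * n)"
            using d n2 by (simp add: \<kappa>_def)
          also have "\<dots> \<le> real k / (2 * d * n)"
            using k d n2 by (intro divide_right_mono) auto
          finally have "exp (- (real k / (2 * d * n))) \<le> n powr (- (\<gamma> + 1))"
            using n2 by (simp add: powr_def algebra_simps)
          then have "n * exp (- (real k / (2 * d * n))) \<le> n * n powr (- (\<gamma> + 1))"
            using n2 by (intro mult_left_mono) auto
          also have "\<dots> = n powr (- \<gamma>)"
            using n2 powr_add[of n 1 "- (\<gamma> + 1)"] by simp
          finally show ?thesis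
            using Z by (simp add: n_def)
        qed
        finally show ?thesis
          using C_ge by (simp add: algebra_simps)
      qed
    qed
    then show ?thesis
      by (simp add: n_def m_def)
  qed
  with \<beta>(1) show ?thesis by blast
qed

end
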